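(* Consider a constrained dynamic game $\mathcal{G} = ( \mathcal{N}, \{\Gamma^i\}_{i\in\mathcal{N}}, \{J^i\}_{i\in\mathcal{N}},\{\mathcal{C}_k\}_{k\in\{0,\ldots,T\}},f,x_0 )$ with $N$ agents whose stage-wise and terminal costs are, for every $i\in\mathcal{N}$, $$L^i_k(x_k,u_k)=L^{ii}_k(x^i_k,u^i_k)+\sum_{j=1,\,j\ne i}^{N}c^{ij}_kL^{ij}_k(x^i_k,x^j_k)\quad(0\le k\le T-1),\qquad L^i_T(x_T)=L^{ii}_T(x^i_T)+\sum_{j=1,\,j\ne i}^{N}c^{ij}_TL^{ij}_T(x^i_T,x^j_T),$$ with $c^{ij}_k>0$ for all $i,j\in\mathcal{N}$ and $k\in\{0,1,\ldots,T\}$. Assume that for any two agents $i\ne j$ and every $1\le k\le T-1$, $L^{ij}_k(x^i_k,x^j_k)=L^{ji}_k(x^j_k,x^i_k)$ for all $x^i_k\in\mathcal{X}^i$, $x^j_k\in\mathcal{X}^j$, and likewise $L^{ij}_T(x^i_T,x^j_T)=L^{ji}_T(x^j_T,x^i_T)$ for all $x^i_T\in\mathcal{X}^i$, $x^j_T\in\mathcal{X}^j$. If for every agent $i\in\mathcal{N}$ (and every $k\in\{0,\ldots,T\}$) we have $c^{ij}_k=c^i_k$ for all $j\in\mathcal{N}\setminus\{i\}$, then $\mathcal{G}$ is a WCPDG with weights $$w^i_k=\frac{1}{\prod_{j=1,\,j\ne i}^{N}c^j_k},\qquad 0\le k\le T,$$ and a corresponding potential function is $P(x,u)=L_T(x_T)+\sum_{k=0}^{T-1}L_k(x_k,u_k)$,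 where $$L_k(x_k,u_k)=\sum_{i=1}^{N}\Big(\prod_{j=1,\,j\ne i}^{N}c^j_k\Big)L^{ii}_k(x^i_k,u^i_k)+\Big(\prod_{l=1}^{N}c^l_k\Big)\sum_{i=1}^{N-1}\sum_{j=i+1}^{N}L^{ij}_k(x^i_k,x^j_k),$$ $$L_T(x_T)=\sum_{i=1}^{N}\Big(\prod_{j=1,\,j\ne i}^{N}c^j_T\Big)L^{ii}_T(x^i_T)+\Big(\prod_{l=1}^{N}c^l_T\Big)\sum_{i=1}^{N-1}\sum_{j=i+1}^{N}L^{ij}_T(x^i_T,x^j_T).$$
   Context: Setting. $\mathcal{N}=\{1,\ldots,N\}$ is the set of agents and $T$ is a finite horizon. Agent $i$ has state space $\mathcal{X}^i\subseteq\mathbb{R}^{n_i}$ and action space $\mathcal{U}^i\subseteq\mathbb{R}^{m_i}$; $\mathcal{X}=\prod_i\mathcal{X}^i$, $\mathcal{U}=\prod_i\mathcal{U}^i$. The joint state and action at time $k$ are $x_k=(x^1_k,\ldots,x^N_k)$ and $u_k=(u^1_k,\ldots,u^N_k)$; $x=\{x_k\}_{k=0}^{T}$, $u=\{u_k\}_{k=0}^{T-1}$. A superscript $-i$ denotes the tuple of components of all agents except $i$; the superscripts on $c^{ij}_k$, $c^i_k$ and $L^{ij}_k$ are indices, not powers. The initial state $x_0$ is fixed. Each agent has separate dynamics $x^i_{k+1}=f^i(x^i_k,u^i_k)$; jointly $x_{k+1}=f(x_k,u_k)$ with $f=(f^1,\ldots,f^N)$. The shared inequality constraints are $g(x_k,u_k)\le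 0$ (elementwise, $g:\mathcal{X}\times\mathcal{U}\to\mathbb{R}^c$) for $0\le k\le T-1$ and $g(x_T)\le 0$ at the terminal time (a function of the terminal state only). $\mathcal{C}_k$ is the set of feasible pairs $(x_k,u_k)$ at time $k\le T-1$ (in $\mathcal{X}\times\mathcal{U}$, consistent with the dynamics, satisfying $g(x_k,u_k)\le0$), and $\mathcal{C}_T=\{x_T\in\mathcal{X}: g(x_T)\le 0\}$. Costs. Agent $i$ minimizes $J^i(x,u)=L^i_T(x_T)+\sum_{k=0}^{T-1}L^i_k(x_k,u_k)$. Strategies. An open-loop strategy of agent $i$ is $\gamma^i=\{\gamma^i_k\}_{k=0}^{T-1}$, determined by $x_0$ and time, $u^i_k=\gamma^i(x_0,k)$; for given $x_0$ it is identified with the action sequence of agent $i$. $\Gamma^i$ is the strategy space of agent $i$, $\Gamma=\prod_i\Gamma^i$. A joint strategy $\gamma$ is feasible if the state-action trajectory $(x,u)$ it generates from $x_0$ satisfies $(x_k,u_k)\in\mathcal{C}_k$ for $0\le k\le T-1$ and $x_T\in\mathcal{C}_T$; such $(x,u)$ is called a feasible system trajectory. WCPDG. $\mathcal{G}$ is a weighted constrained potential dynamic game (WCPDG, also called a $w$-potential game) with positive weights $w=(w^i_k)_{i\in\mathcal{N},\,0\le k\le T}$ if there exists a potential functional $P(x,u)=L_T(x_T)+\sum_{k=0}^{T-1}L_k(x_k,u_k)$ such that for every agent $i$, all strategies $\gamma^i,\nu^i\in\Gamma^i$ and $\gamma^{-i}\in\Gamma^{-i}$ with $(\gamma^i,\gamma^{-i})$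 and $(\nu^i,\gamma^{-i})$ feasible, $$J^i(x,u)-J^i(x',u')=w^i_T\big(L_T(x_T)-L_T(x'_T)\big)+\sum_{k=0}^{T-1}w^i_k\big(L_k(x_k,u_k)-L_k(x'_k,u'_k)\big),$$ where $(x,u)$ and $(x',u')$ are the feasible system trajectories generated by $(\gamma^i,\gamma^{-i})$ and $(\nu^i,\gamma^{-i})$, respectively (both starting from $x_0$). Standing assumptions. The costs $L^i_k$ and $L^i_T$ are continuously differentiable on $\mathcal{X}\times\mathcal{U}$ and $\mathcal{X}$, respectively. The dynamics $f$ and constraints $g$ are continuously differentiable on $\mathcal{X}\times\mathcal{U}$ and satisfy some regularity conditions (such as linear independence of gradients or the Mangasarian-Fromovitz constraint qualification). *)

theory Defs
  imports "HOL-Analysis.Analysis"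
begin

text \<open>
  Agents are the elements of a finite linearly ordered type \<open>'a\<close>, i.e. \<open>1 < ... < N\<close> with
  \<open>N = CARD('a)\<close>.  Agents may have state and action spaces of different dimensions.  To fit
  them into one type, the space \<open>R^(n_i)\<close> of agent \<open>i\<close> is realised as the coordinate subspace
  of \<open>real^'n\<close> spanned by a set of \<open>n_i\<close> coordinates, the unused coordinates being zero.
\<close>

definition coord_space :: "'n set \<Rightarrow> (real^'n::finite) set" where
  "coord_space S = {v. \<forall>l. l \<notin> S \<longrightarrow> v $ l = 0}"

text \<open>
  Continuous differentiability on a set that need not be open: there is a continuously
  (Frechet) differentiable extension to an open neighbourhood.  For open \<open>S\<close> this is the
  usual notion, and padding by unused coordinates does not affect it.
\<close>

definition cont_diff_on ::
  "('v::euclidean_space \<Rightarrow> 'w::euclidean_space) \<Rightarrow> 'v set \<Rightarrow> bool" where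
  "cont_diff_on h S \<longleftrightarrow>
    (\<exists>W H (H' :: 'v \<Rightarrow> 'v \<Rightarrow>\<^sub>L 'w). open W \<and> S \<subseteq> W \<and> (\<forall>z\<in>S. H z = h z) \<and>
       (\<forall>z\<in>W. (H has_derivative blinfun_apply (H' z)) (at z)) \<and> continuous_on W H')"

type_synonym ('a, 'n) state = "real^'n^'a"
type_synonym ('a, 'm) action = "real^'m^'a"

text \<open>An open-loop strategy assigns an action to the initial state and the time.\<close>

type_synonym ('a, 'n, 'm) strategy = "('a, 'n) state \<Rightarrow> nat \<Rightarrow> real^'m"

record ('a::finite, 'n::finite, 'm::finite, 'c::finite, 'd::finite) game =
  horizon :: nat
  state_coords :: "'a \<Rightarrow> 'n set"
  action_coords :: "'a \<Rightarrow> 'm set"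
  state_space :: "'a \<Rightarrow> (real^'n) set"
  action_space :: "'a \<Rightarrow> (real^'m) set"
  strategy_space :: "'a \<Rightarrow> ('a, 'n, 'm) strategy set"
  stage_cost :: "'a \<Rightarrow> nat \<Rightarrow> ('a, 'n) state \<Rightarrow> ('a, 'm) action \<Rightarrow> real"
  terminal_cost :: "'a \<Rightarrow> ('a, 'n) state \<Rightarrow> real"
  agent_dynamics :: "'a \<Rightarrow> real^'n \<Rightarrow> real^'m \<Rightarrow> real^'n"
  stage_constraint :: "('a, 'n) state \<Rightarrow> ('a, 'm) action \<Rightarrow> real^'c"
  terminal_constraint :: "('a, 'n) state \<Rightarrow> real^'d"
  initial_state :: "('a, 'n) state"

definition joint_states ::
  "('a::finite, 'n::finite, 'm::finite, 'c::finite, 'd::finite) game \<Rightarrow> ('a, 'n) state set" where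
  "joint_states G = {x. \<forall>i. x $ i \<in> state_space G i}"

definition joint_actions ::
  "('a::finite, 'n::finite, 'm::finite, 'c::finite, 'd::finite) game \<Rightarrow> ('a, 'm) action set" where
  "joint_actions G = {u. \<forall>i. u $ i \<in> action_space G i}"

definition joint_dynamics ::
  "('a::finite, 'n::finite, 'm::finite, 'c::finite, 'd::finite) game
    \<Rightarrow> ('a, 'n) state \<Rightarrow> ('a, 'm) action \<Rightarrow> ('a, 'n) state" where
  "joint_dynamics G x u = (\<chi> i. agent_dynamics G i (x $ i) (u $ i))"

text \<open>
  Feasible pairs at a non-terminal time.  Neither dynamics nor constraints depend on the time,
  so one set serves all of them.  Consistency with the dynamics means that the successor is
  again a state.
\<close>

definition feasible_stage ::
  "('a::finite, 'n::finite, 'm::finite, 'c::finite, 'd::finite) game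
    \<Rightarrow> (('a, 'n) state \<times> ('a, 'm) action) set" where
  "feasible_stage G = {(x, u). x \<in> joint_states G \<and> u \<in> joint_actions G \<and>
     joint_dynamics G x u \<in> joint_states G \<and> (\<forall>l. stage_constraint G x u $ l \<le> 0)}"

definition feasible_terminal ::
  "('a::finite, 'n::finite, 'm::finite, 'c::finite, 'd::finite) game \<Rightarrow> ('a, 'n) state set" where
  "feasible_terminal G = {x \<in> joint_states G. \<forall>l. terminal_constraint G x $ l \<le> 0}"

definition action_traj ::
  "('a::finite, 'n::finite, 'm::finite, 'c::finite, 'd::finite) game
    \<Rightarrow> ('a \<Rightarrow> ('a, 'n, 'm) strategy) \<Rightarrow> nat \<Rightarrow> ('a, 'm) action" where
  "action_traj G \<gamma> k = (\<chi> i. \<gamma> i (initial_state G) k)"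

primrec state_traj ::
  "('a::finite, 'n::finite, 'm::finite, 'c::finite, 'd::finite) game
    \<Rightarrow> ('a \<Rightarrow> ('a, 'n, 'm) strategy) \<Rightarrow> nat \<Rightarrow> ('a, 'n) state" where
  "state_traj G \<gamma> 0 = initial_state G"
| "state_traj G \<gamma> (Suc k) = joint_dynamics G (state_traj G \<gamma> k) (action_traj G \<gamma> k)"

definition feasible_strategy ::
  "('a::finite, 'n::finite, 'm::finite, 'c::finite, 'd::finite) game
    \<Rightarrow> ('a \<Rightarrow> ('a, 'n, 'm) strategy) \<Rightarrow> bool" where
  "feasible_strategy G \<gamma> \<longleftrightarrow>
     (\<forall>k < horizon G. (state_traj G \<gamma> k, action_traj G \<gamma> k) \<in> feasible_stage G) \<and>
     state_traj G \<gamma> (horizon G) \<in> feasible_terminal G"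

text \<open>
  Functionals on trajectories are given the whole sequences; only the states up to time \<open>T\<close>
  and the actions before time \<open>T\<close> enter.
\<close>

definition additive_functional ::
  "nat \<Rightarrow> (nat \<Rightarrow> 's \<Rightarrow> 'u \<Rightarrow> real) \<Rightarrow> ('s \<Rightarrow> real) \<Rightarrow> (nat \<Rightarrow> 's) \<Rightarrow> (nat \<Rightarrow> 'u) \<Rightarrow> real" where
  "additive_functional T L L\<^sub>T x u = L\<^sub>T (x T) + (\<Sum>k<T. L k (x k) (u k))"

definition agent_cost ::
  "('a::finite, 'n::finite, 'm::finite, 'c::finite, 'd::finite) game
    \<Rightarrow> 'a \<Rightarrow> (nat \<Rightarrow> ('a, 'n) state) \<Rightarrow> (nat \<Rightarrow> ('a, 'm) action) \<Rightarrow> real" where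
  "agent_cost G i = additive_functional (horizon G) (stage_cost G i) (terminal_cost G i)"

definition constrained_dynamic_game ::
  "('a::finite, 'n::finite, 'm::finite, 'c::finite, 'd::finite) game \<Rightarrow> bool" where
  "constrained_dynamic_game G \<longleftrightarrow>
     (\<forall>i. state_space G i \<subseteq> coord_space (state_coords G i)) \<and>
     (\<forall>i. action_space G i \<subseteq> coord_space (action_coords G i)) \<and>
     (\<forall>i. \<forall>a \<in> state_space G i. \<forall>b \<in> action_space G i.
        agent_dynamics G i a b \<in> coord_space (state_coords G i)) \<and>
     initial_state G \<in> joint_states G \<and>
     (\<forall>i. \<forall>\<gamma> \<in> strategy_space G i. \<forall>k < horizon G. \<gamma> (initial_state G) k \<in> action_space G i) \<and>
     (\<forall>i. \<forall>k < horizon G.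
        cont_diff_on (\<lambda>(x, u). stage_cost G i k x u) (joint_states G \<times> joint_actions G)) \<and>
     (\<forall>i. cont_diff_on (terminal_cost G i) (joint_states G)) \<and>
     cont_diff_on (\<lambda>(x, u). joint_dynamics G x u) (joint_states G \<times> joint_actions G) \<and>
     cont_diff_on (\<lambda>(x, u). stage_constraint G x u) (joint_states G \<times> joint_actions G) \<and>
     cont_diff_on (terminal_constraint G) (joint_states G)"

text \<open>
  \<open>P\<close> is a potential functional with stage terms \<open>L\<close> and terminal term \<open>L\<^sub>T\<close>.  The strategies
  of the agents other than \<open>i\<close> are given by a profile \<open>\<gamma>\<close> whose entry at \<open>i\<close> is overwritten.
\<close>

definition weighted_potential ::
  "('a::finite, 'n::finite, 'm::finite, 'c::finite, 'd::finite) game \<Rightarrow> ('a \<Rightarrow> nat \<Rightarrow> real)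
    \<Rightarrow> ((nat \<Rightarrow> ('a, 'n) state) \<Rightarrow> (nat \<Rightarrow> ('a, 'm) action) \<Rightarrow> real)
    \<Rightarrow> (nat \<Rightarrow> ('a, 'n) state \<Rightarrow> ('a, 'm) action \<Rightarrow> real) \<Rightarrow> (('a, 'n) state \<Rightarrow> real) \<Rightarrow> bool" where
  "weighted_potential G w P L L\<^sub>T \<longleftrightarrow>
     P = additive_functional (horizon G) L L\<^sub>T \<and>
     (\<forall>i. \<forall>\<gamma>i \<in> strategy_space G i. \<forall>\<nu>i \<in> strategy_space G i. \<forall>\<gamma>.
        (\<forall>j. j \<noteq> i \<longrightarrow> \<gamma> j \<in> strategy_space G j) \<longrightarrow>
        feasible_strategy G (\<gamma>(i := \<gamma>i)) \<longrightarrow> feasible_strategy G (\<gamma>(i := \<nu>i)) \<longrightarrow>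
        (let T = horizon G;
             x = state_traj G (\<gamma>(i := \<gamma>i)); u = action_traj G (\<gamma>(i := \<gamma>i));
             x' = state_traj G (\<gamma>(i := \<nu>i)); u' = action_traj G (\<gamma>(i := \<nu>i))
         in agent_cost G i x u - agent_cost G i x' u' =
              w i T * (L\<^sub>T (x T) - L\<^sub>T (x' T)) +
              (\<Sum>k<T. w i k * (L k (x k) (u k) - L k (x' k) (u' k)))))"

definition WCPDG ::
  "('a::finite, 'n::finite, 'm::finite, 'c::finite, 'd::finite) game
    \<Rightarrow> ('a \<Rightarrow> nat \<Rightarrow> real) \<Rightarrow> bool" where
  "WCPDG G w \<longleftrightarrow> (\<forall>i. \<forall>k \<le> horizon G. w i k > 0) \<and> (\<exists>P L L\<^sub>T. weighted_potential G w P L L\<^sub>T)"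

end

theory Submission
  imports Defs
begin

text \<open>
  When agent \<open>i\<close> deviates, only its own self cost and the pair costs involving it change, and
  by symmetry each such pair occurs once in the upper-triangular sum of the potential.  So the
  potential changes by the product of the \<open>c\<^sup>j\<close> with \<open>j \<noteq> i\<close> times the change in the cost of
  agent \<open>i\<close>.  At time \<open>0\<close> no symmetry is needed: the state is fixed, so no pair cost changes.
\<close>

text \<open>Row \<open>i\<close> supplies the entries with \<open>l > i\<close>, and each row
  \<open>j < i\<close> supplies its entry in column \<open>i\<close>, which symmetry carries over to
  row \<open>i\<close>. The diagonal entry \<open>p i i\<close> lies outside both sums.\<close>

lemma sum_upper_triangle_row:
  fixes p :: "'a::{finite,linorder} \<Rightarrow> 'a \<Rightarrow> real"
  assumes off: "\<And>j l. j \<noteq> i \<Longrightarrow> l \<noteq> i \<Longrightarrow> p j l = 0"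
    and sym: "\<And>j. j \<noteq> i \<Longrightarrow> p i j = p j i"
  shows "(\<Sum>j\<in>UNIV. \<Sum>l\<in>{j<..}. p j l) = (\<Sum>l\<in>UNIV - {i}. p i l)"
proof -
  \<comment> \<open>A row \<open>j\<close> other than \<open>i\<close> can be nonzero only in column
    \<open>i\<close>, which lies in the triangle precisely when \<open>j < i\<close>.\<close>
  have row: "(\<Sum>l\<in>{j<..}. p j l) = (if j < i then p i j else 0)" if "j \<noteq> i" for j
  proof -
    have "(\<Sum>l\<in>{j<..}. p j l) = (\<Sum>l\<in>{j<..}. if l = i then p j i else 0)"
      using off that by (intro sum.cong) auto
    then show ?thesis
      using sym[OF that] by simp
  qed
  have "(\<Sum>j\<in>UNIV. \<Sum>l\<in>{j<..}. p j l) =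
      (\<Sum>l\<in>{i<..}. p i l) + (\<Sum>j\<in>UNIV - {i}. if j < i then p i j else 0)"
    using row by (subst sum.remove[of _ i]) simp_all
  also have "(\<Sum>j\<in>UNIV - {i}. if j < i then p i j else 0) = (\<Sum>j\<in>{..<i}. p i j)"
    by (intro sum.mono_neutral_cong_right) auto
  also have "(\<Sum>l\<in>{i<..}. p i l) + (\<Sum>j\<in>{..<i}. p i j) = (\<Sum>l\<in>{i<..} \<union> {..<i}. p i l)"
    by (rule sum.union_disjoint[symmetric]) auto
  also have "{i<..} \<union> {..<i} = UNIV - {i}"
    by auto
  finally show ?thesis .
qed

text \<open>This is the comparison at one fixed time: \<open>s\<close> and \<open>p\<close> hold the
  self and pair costs on one trajectory, \<open>s'\<close> and \<open>p'\<close> those on the other.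
  Symmetry is asked of the differences only, so that time 0 is covered too, and positivity only of
  the coefficients that enter the divisor.\<close>

lemma unilateral_potential_change:
  fixes c s s' :: "'a::{finite,linorder} \<Rightarrow> real" and p p' :: "'a \<Rightarrow> 'a \<Rightarrow> real"
  assumes c: "\<And>j. j \<noteq> i \<Longrightarrow> c j > 0"
    and s: "\<And>j. j \<noteq> i \<Longrightarrow> s j = s' j"
    and off: "\<And>j l. j \<noteq> i \<Longrightarrow> l \<noteq> i \<Longrightarrow> p j l = p' j l"
    and sym: "\<And>j. j \<noteq> i \<Longrightarrow> p i j - p' i j = p j i - p' j i"
  shows "(s i + (\<Sum>j\<in>UNIV - {i}. c i * p i j)) - (s' i + (\<Sum>j\<in>UNIV - {i}. c i * p' i j)) =
    1 / (\<Prod>j\<in>UNIV - {i}. c j) *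
      (((\<Sum>j\<in>UNIV. (\<Prod>l\<in>UNIV - {j}. c l) * s j) +
          (\<Prod>l\<in>UNIV. c l) * (\<Sum>j\<in>UNIV. \<Sum>l\<in>{j<..}. p j l)) -
       ((\<Sum>j\<in>UNIV. (\<Prod>l\<in>UNIV - {j}. c l) * s' j) +
          (\<Prod>l\<in>UNIV. c l) * (\<Sum>j\<in>UNIV. \<Sum>l\<in>{j<..}. p' j l)))"
proof -
  \<comment> \<open>\<open>q\<close> is the coefficient of the self cost of agent \<open>i\<close>
    and also the cofactor of \<open>c i\<close> in the full product; the weight cancels this shared
    factor.\<close>
  define q where "q = (\<Prod>j\<in>UNIV - {i}. c j)"
  have q: "q > 0"
    unfolding q_def using c by (intro prod_pos) auto
  have all: "(\<Prod>l\<in>UNIV. c l) = c i * q"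
    unfolding q_def by (rule prod.remove) auto
  have self: "(\<Sum>j\<in>UNIV. (\<Prod>l\<in>UNIV - {j}. c l) * s j) -
      (\<Sum>j\<in>UNIV. (\<Prod>l\<in>UNIV - {j}. c l) * s' j) = q * (s i - s' i)"
    using s by (simp add: sum.remove[of UNIV i] q_def algebra_simps)
  \<comment> \<open>Pairs avoiding \<open>i\<close> cancel, so the difference of the two matrices is
    supported on row and column \<open>i\<close>.\<close>
  have "(\<Sum>j\<in>UNIV. \<Sum>l\<in>{j<..}. p j l - p' j l) = (\<Sum>l\<in>UNIV - {i}. p i l - p' i l)"
    using off sym by (intro sum_upper_triangle_row) auto
  then have pair: "(\<Sum>j\<in>UNIV. \<Sum>l\<in>{j<..}. p j l) - (\<Sum>j\<in>UNIV. \<Sum>l\<in>{j<..}. p' j l) =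
      (\<Sum>l\<in>UNIV - {i}. p i l) - (\<Sum>l\<in>UNIV - {i}. p' i l)"
    by (simp add: sum_subtractf)
  let ?S = "\<lambda>s. \<Sum>j\<in>UNIV. (\<Prod>l\<in>UNIV - {j}. c l) * s j"
  let ?U = "\<lambda>p. \<Sum>j\<in>UNIV. \<Sum>l\<in>{j<..}. p j l"
  let ?R = "\<lambda>p. \<Sum>l\<in>UNIV - {i}. p i l"
  have "(?S s + c i * q * ?U p) - (?S s' + c i * q * ?U p') =
      (?S s - ?S s') + c i * q * (?U p - ?U p')"
    by (simp add: algebra_simps)
  also have "\<dots> = q * ((s i + c i * ?R p) - (s' i + c i * ?R p'))"
    unfolding self pair by (simp add: algebra_simps)
  finally show ?thesis
    using q unfolding all q_def[symmetric] sum_distrib_left[symmetric] by simp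
qed

lemma action_traj_other:
  "j \<noteq> i \<Longrightarrow> action_traj G (\<gamma>(i := \<alpha>)) k $ j = action_traj G (\<gamma>(i := \<beta>)) k $ j"
  by (simp add: action_traj_def)

text \<open>The dynamics are separate: the next state of agent \<open>j\<close> depends only on its
  own state and action, so a deviation of agent \<open>i\<close> never reaches it.\<close>

lemma state_traj_other:
  "j \<noteq> i \<Longrightarrow> state_traj G (\<gamma>(i := \<alpha>)) k $ j = state_traj G (\<gamma>(i := \<beta>)) k $ j"
  by (induction k) (simp_all add: joint_dynamics_def action_traj_other[of j i G \<gamma> \<alpha> _ \<beta>])

lemma feasible_strategy_stageD:
  assumes "feasible_strategy G \<gamma>" and "k < horizon G"
  shows "state_traj G \<gamma> k \<in> joint_states G" and "action_traj G \<gamma> k \<in> joint_actions G"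
  using assms by (auto simp: feasible_strategy_def feasible_stage_def)

lemma feasible_strategy_terminalD:
  "feasible_strategy G \<gamma> \<Longrightarrow> state_traj G \<gamma> (horizon G) \<in> joint_states G"
  by (simp add: feasible_strategy_def feasible_terminal_def)

text \<open>The inner sum over \<open>{i<..}\<close> is empty at the largest agent, so letting
  \<open>i\<close> range over all agents still gives the sum over pairs
  \<open>i < j\<close>.\<close>

theorem lemma4:
  fixes G :: "('a::{finite,linorder}, 'n::finite, 'm::finite, 'c::finite, 'd::finite) game"
    and c :: "'a \<Rightarrow> 'a \<Rightarrow> nat \<Rightarrow> real"
    and cs :: "'a \<Rightarrow> nat \<Rightarrow> real"
    and Lself :: "'a \<Rightarrow> nat \<Rightarrow> real^'n \<Rightarrow> real^'m \<Rightarrow> real"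
    and LTself :: "'a \<Rightarrow> real^'n \<Rightarrow> real"
    and Lpair :: "'a \<Rightarrow> 'a \<Rightarrow> nat \<Rightarrow> real^'n \<Rightarrow> real^'n \<Rightarrow> real"
    and LTpair :: "'a \<Rightarrow> 'a \<Rightarrow> real^'n \<Rightarrow> real^'n \<Rightarrow> real"
    and T :: nat
  assumes game: "constrained_dynamic_game G"
    and T: "T = horizon G"
    and stage: "\<And>i k x u. k < T \<Longrightarrow> x \<in> joint_states G \<Longrightarrow> u \<in> joint_actions G \<Longrightarrow>
        stage_cost G i k x u =
          Lself i k (x $ i) (u $ i) + (\<Sum>j\<in>UNIV - {i}. c i j k * Lpair i j k (x $ i) (x $ j))"
    and terminal: "\<And>i x. x \<in> joint_states G \<Longrightarrow>
        terminal_cost G i x =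
          LTself i (x $ i) + (\<Sum>j\<in>UNIV - {i}. c i j T * LTpair i j (x $ i) (x $ j))"
    and c_pos: "\<And>i j k. k \<le> T \<Longrightarrow> c i j k > 0"
    and sym_stage: "\<And>i j k a b. i \<noteq> j \<Longrightarrow> 1 \<le> k \<Longrightarrow> k < T \<Longrightarrow>
        a \<in> state_space G i \<Longrightarrow> b \<in> state_space G j \<Longrightarrow> Lpair i j k a b = Lpair j i k b a"
    and sym_terminal: "\<And>i j a b. i \<noteq> j \<Longrightarrow>
        a \<in> state_space G i \<Longrightarrow> b \<in> state_space G j \<Longrightarrow> LTpair i j a b = LTpair j i b a"
    and c_eq: "\<And>i j k. k \<le> T \<Longrightarrow> j \<noteq> i \<Longrightarrow> c i j k = cs i k"
  shows "let w = (\<lambda>i k. 1 / (\<Prod>j\<in>UNIV - {i}. cs j k));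
             L = (\<lambda>k x u.
               (\<Sum>i\<in>UNIV. (\<Prod>j\<in>UNIV - {i}. cs j k) * Lself i k (x $ i) (u $ i)) +
               (\<Prod>l\<in>UNIV. cs l k) * (\<Sum>i\<in>UNIV. \<Sum>j\<in>{i<..}. Lpair i j k (x $ i) (x $ j)));
             L\<^sub>T = (\<lambda>x.
               (\<Sum>i\<in>UNIV. (\<Prod>j\<in>UNIV - {i}. cs j T) * LTself i (x $ i)) +
               (\<Prod>l\<in>UNIV. cs l T) * (\<Sum>i\<in>UNIV. \<Sum>j\<in>{i<..}. LTpair i j (x $ i) (x $ j)));
             P = (\<lambda>x u. L\<^sub>T (x T) + (\<Sum>k<T. L k (x k) (u k)))
         in WCPDG G w \<and> weighted_potential G w P L L\<^sub>T"
proof -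
  define w where "w = (\<lambda>i k. 1 / (\<Prod>j\<in>UNIV - {i}. cs j k))"
  define L where "L = (\<lambda>k (x :: ('a, 'n) state) (u :: ('a, 'm) action).
    (\<Sum>i\<in>UNIV. (\<Prod>j\<in>UNIV - {i}. cs j k) * Lself i k (x $ i) (u $ i)) +
    (\<Prod>l\<in>UNIV. cs l k) * (\<Sum>i\<in>UNIV. \<Sum>j\<in>{i<..}. Lpair i j k (x $ i) (x $ j)))"
  define LT where "LT = (\<lambda>x :: ('a, 'n) state.
    (\<Sum>i\<in>UNIV. (\<Prod>j\<in>UNIV - {i}. cs j T) * LTself i (x $ i)) +
    (\<Prod>l\<in>UNIV. cs l T) * (\<Sum>i\<in>UNIV. \<Sum>j\<in>{i<..}. LTpair i j (x $ i) (x $ j)))"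
  \<comment> \<open>With a single agent \<open>cs\<close> is unconstrained, so positivity needs a second agent.\<close>
  have cs_pos: "cs j k > 0" if "k \<le> T" "j \<noteq> i" for i j k
    using c_pos[of k j i] c_eq[of k i j] that by simp
  \<comment> \<open>Each factor has an index different from \<open>i\<close>, so
    \<open>cs_pos\<close> applies; with a single agent the product is empty and the weight is
    1.\<close>
  have w_pos: "w i k > 0" if "k \<le> T" for i k
    unfolding w_def using cs_pos that by (auto intro!: prod_pos)
  have potential: "weighted_potential G w (\<lambda>x u. LT (x T) + (\<Sum>k<T. L k (x k) (u k))) L LT"
    unfolding weighted_potential_def Let_def
  proof (intro conjI allI ballI impI)
    show "(\<lambda>x u. LT (x T) + (\<Sum>k<T. L k (x k) (u k))) = additive_functional (horizon G) L LT"
      by (simp add: fun_eq_iff additive_functional_def T)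
  next
    fix i \<alpha> \<beta> and \<gamma> :: "'a \<Rightarrow> ('a, 'n, 'm) strategy"
    assume fa: "feasible_strategy G (\<gamma>(i := \<alpha>))" and fb: "feasible_strategy G (\<gamma>(i := \<beta>))"
    define x where "x = state_traj G (\<gamma>(i := \<alpha>))"
    define u where "u = action_traj G (\<gamma>(i := \<alpha>))"
    define x' where "x' = state_traj G (\<gamma>(i := \<beta>))"
    define u' where "u' = action_traj G (\<gamma>(i := \<beta>))"
    note defs = x_def u_def x'_def u'_def
    have x_other: "x k $ j = x' k $ j" and u_other: "u k $ j = u' k $ j" if "j \<noteq> i" for j k
      unfolding defs using that by (rule state_traj_other action_traj_other)+
    \<comment> \<open>The cost formulas and symmetries are assumed only on the state and action
      spaces; feasibility of both profiles places the trajectories there.\<close>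
    have stage_mem: "x k \<in> joint_states G" "u k \<in> joint_actions G"
        "x' k \<in> joint_states G" "u' k \<in> joint_actions G" if "k < T" for k
      unfolding defs using that feasible_strategy_stageD[OF fa] feasible_strategy_stageD[OF fb] T
      by auto
    have terminal_mem: "x T \<in> joint_states G" "x' T \<in> joint_states G"
      unfolding defs T using feasible_strategy_terminalD fa fb by auto
    have stage_diff: "stage_cost G i k (x k) (u k) - stage_cost G i k (x' k) (u' k) =
        w i k * (L k (x k) (u k) - L k (x' k) (u' k))" if k: "k < T" for k
    proof -
      have sym: "Lpair i j k (x k $ i) (x k $ j) - Lpair i j k (x' k $ i) (x' k $ j) =
          Lpair j i k (x k $ j) (x k $ i) - Lpair j i k (x' k $ j) (x' k $ i)" if "j \<noteq> i" for j
      \<comment> \<open>At time 0 both trajectories sit at \<open>initial_state G\<close> and each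
        side is zero; later, symmetry is used on each trajectory separately.\<close>
      proof (cases "k = 0")
        case True
        then show ?thesis by (simp add: x_def x'_def)
      next
        case False
        then show ?thesis
          using sym_stage[of i j k] that k stage_mem[OF k] by (simp add: joint_states_def)
      qed
      \<comment> \<open>All pair costs of agent \<open>i\<close> now share the coefficient
        \<open>cs i k\<close>, as in \<open>unilateral_potential_change\<close>.\<close>
      have cost: "stage_cost G i k y v = Lself i k (y $ i) (v $ i) +
          (\<Sum>j\<in>UNIV - {i}. cs i k * Lpair i j k (y $ i) (y $ j))"
        if "y \<in> joint_states G" "v \<in> joint_actions G" for y v
        using stage[OF k that] c_eq[of k _ i] k by (auto intro!: sum.cong)
      show ?thesis
        unfolding cost[OF stage_mem(1,2)[OF k]] cost[OF stage_mem(3,4)[OF k]] L_def w_def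
        by (rule unilateral_potential_change[where i = i and c = "\<lambda>j. cs j k"
              and s = "\<lambda>j. Lself j k (x k $ j) (u k $ j)"
              and s' = "\<lambda>j. Lself j k (x' k $ j) (u' k $ j)"
              and p = "\<lambda>j l. Lpair j l k (x k $ j) (x k $ l)"
              and p' = "\<lambda>j l. Lpair j l k (x' k $ j) (x' k $ l)"])
          (use cs_pos k sym in \<open>auto simp: x_other u_other\<close>)
    qed
    have terminal_diff: "terminal_cost G i (x T) - terminal_cost G i (x' T) =
        w i T * (LT (x T) - LT (x' T))"
    proof -
      \<comment> \<open>Terminal symmetry is assumed for every \<open>T\<close>, so
        \<open>T = 0\<close> needs no separate case.\<close>
      have sym: "LTpair i j (x T $ i) (x T $ j) - LTpair i j (x' T $ i) (x' T $ j) =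
          LTpair j i (x T $ j) (x T $ i) - LTpair j i (x' T $ j) (x' T $ i)" if "j \<noteq> i" for j
        using sym_terminal[of i j] that terminal_mem by (simp add: joint_states_def)
      have cost: "terminal_cost G i y = LTself i (y $ i) +
          (\<Sum>j\<in>UNIV - {i}. cs i T * LTpair i j (y $ i) (y $ j))" if "y \<in> joint_states G" for y
        using terminal[OF that] c_eq[of T _ i] by (auto intro!: sum.cong)
      show ?thesis
        unfolding cost[OF terminal_mem(1)] cost[OF terminal_mem(2)] LT_def w_def
        by (rule unilateral_potential_change[where i = i and c = "\<lambda>j. cs j T"
              and s = "\<lambda>j. LTself j (x T $ j)" and s' = "\<lambda>j. LTself j (x' T $ j)"
              and p = "\<lambda>j l. LTpair j l (x T $ j) (x T $ l)"
              and p' = "\<lambda>j l. LTpair j l (x' T $ j) (x' T $ l)"])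
          (use cs_pos sym in \<open>auto simp: x_other\<close>)
    qed
    \<comment> \<open>The weights vary with time, so the identity is established term by term and
      only then summed.\<close>
    have "agent_cost G i x u - agent_cost G i x' u' =
        (terminal_cost G i (x T) - terminal_cost G i (x' T)) +
        (\<Sum>k<T. stage_cost G i k (x k) (u k) - stage_cost G i k (x' k) (u' k))"
      by (simp add: agent_cost_def additive_functional_def T sum_subtractf)
    also have "\<dots> = w i T * (LT (x T) - LT (x' T)) +
        (\<Sum>k<T. w i k * (L k (x k) (u k) - L k (x' k) (u' k)))"
      using stage_diff terminal_diff by simp
    finally show "agent_cost G i (state_traj G (\<gamma>(i := \<alpha>))) (action_traj G (\<gamma>(i := \<alpha>))) -
        agent_cost G i (state_traj G (\<gamma>(i := \<beta>))) (action_traj G (\<gamma>(i := \<beta>))) =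
        w i (horizon G) * (LT (state_traj G (\<gamma>(i := \<alpha>)) (horizon G)) -
          LT (state_traj G (\<gamma>(i := \<beta>)) (horizon G))) +
        (\<Sum>k<horizon G. w i k *
          (L k (state_traj G (\<gamma>(i := \<alpha>)) k) (action_traj G (\<gamma>(i := \<alpha>)) k) -
           L k (state_traj G (\<gamma>(i := \<beta>)) k) (action_traj G (\<gamma>(i := \<beta>)) k)))"
      unfolding defs T .
  qed
  then have "WCPDG G w"
    unfolding WCPDG_def using w_pos T by blast
  with potential show ?thesis
    unfolding Let_def w_def L_def LT_def by blast
qed

end
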